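(* Let $d\ge 1$ and let $Z=\{z_1,\dots,z_N\}\subset\mathbb S^d$ be any $N$-point set. Then $$[D_{L^2,\mathrm{hem}}(Z)]^2=\frac12\left(\int_{\mathbb S^d}\int_{\mathbb S^d} d(x,y)\,d\sigma(x)\,d\sigma(y)-\frac1{N^2}\sum_{i,j=1}^N d(z_i,z_j)\right).$$
   Context: $\mathbb S^d\subset\mathbb R^{d+1}$ is the unit sphere, $\sigma$ is the normalized surface measure on it ($\sigma(\mathbb S^d)=1$), and $d(x,y)=\frac1\pi\arccos(x\cdot y)$ is the geodesic distance normalized so that antipodal points are at distance $1$. For $x\in\mathbb S^d$ the open hemisphere is $H(x)=\{z\in\mathbb S^d: z\cdot x>0\}$, so $\sigma(H(x))=\frac12$. The $L^2$ hemisphere discrepancy of $Z=\{z_1,\dots,z_N\}$ is $$D_{L^2,\mathrm{hem}}(Z)=\left(\int_{\mathbb S^d}\Big|\frac1N\sum_{j=1}^N\mathbf 1_{H(x)}(z_j)-\frac12\Big|^2d\sigma(x)\right)^{1/2}.$$ *)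

theory Defs
  imports "HOL-Analysis.Analysis"
begin

(* Surface measure on the unit sphere of an n-dimensional Euclidean space, defined through
   polar coordinates: A has measure n * lborel {r u | 0 < r <= 1, u : A}; see
   emeasure_surface_measure below.  It lives on the Borel subsets of the sphere. *)
definition surface_measure :: "'a::euclidean_space measure" where
  "surface_measure = scale_measure (of_nat DIM('a))
     (distr (restrict_space lborel {x. 0 < norm x \<and> norm x \<le> 1})
            (restrict_space borel (sphere 0 1)) sgn)"

definition sphere_prob :: "'a::euclidean_space measure" where
  "sphere_prob = uniform_measure surface_measure (sphere 0 1)"

definition geo_dist :: "'a::euclidean_space \<Rightarrow> 'a \<Rightarrow> real" where
  "geo_dist x y = (1 / pi) * arccos (x \<bullet> y)"

definition hemisphere :: "'a::euclidean_space \<Rightarrow> 'a set" where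
  "hemisphere x = {z \<in> sphere 0 1. z \<bullet> x > 0}"

definition hem_discrepancy :: "'a::euclidean_space set \<Rightarrow> real" where
  "hem_discrepancy Z =
     sqrt (\<integral>x. \<bar>(1 / real (card Z)) * (\<Sum>z\<in>Z. indicat_real (hemisphere x) z) - 1 / 2\<bar>\<^sup>2 \<partial>sphere_prob)"

lemma space_surface_measure [simp]: "space surface_measure = sphere 0 1"
  by (simp add: surface_measure_def space_scale_measure space_restrict_space)

lemma sets_surface_measure [measurable_cong]:
  "sets surface_measure = sets (restrict_space borel (sphere 0 1))"
  by (simp add: surface_measure_def)

lemma measurable_sgn_sphere:
  "sgn \<in> restrict_space lborel {x::'a::euclidean_space. 0 < norm x \<and> norm x \<le> 1}
          \<rightarrow>\<^sub>M restrict_space borel (sphere 0 1)"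
proof (rule measurable_restrict_space2)
  show "sgn \<in> space (restrict_space lborel {x::'a. 0 < norm x \<and> norm x \<le> 1}) \<rightarrow> sphere 0 1"
    by (auto simp: space_restrict_space norm_sgn)
  have "(\<lambda>x::'a. x /\<^sub>R norm x) \<in> borel_measurable lborel"
    by measurable
  then show "sgn \<in> borel_measurable (restrict_space lborel {x::'a. 0 < norm x \<and> norm x \<le> 1})"
    unfolding sgn_div_norm [abs_def] by (rule measurable_restrict_space1)
qed

lemma emeasure_surface_measure:
  fixes A :: "'a::euclidean_space set"
  assumes A: "A \<in> sets (restrict_space borel (sphere 0 1))"
  shows "emeasure surface_measure A =
    of_nat DIM('a) * emeasure lborel {r *\<^sub>R u | r u. 0 < r \<and> r \<le> 1 \<and> u \<in> A}"
proof -
  let ?B = "{x::'a. 0 < norm x \<and> norm x \<le> 1}"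
  have B: "?B \<in> sets lborel"
    by simp
  have AS: "A \<subseteq> sphere 0 1"
    using sets.sets_into_space[OF A] by (simp add: space_restrict_space)
  have eq: "sgn -` A \<inter> ?B = {r *\<^sub>R u | r u. 0 < r \<and> r \<le> 1 \<and> u \<in> A}"
  proof (intro equalityI subsetI)
    fix x assume x: "x \<in> sgn -` A \<inter> ?B"
    then have "x = norm x *\<^sub>R sgn x"
      by (simp add: sgn_div_norm)
    with x show "x \<in> {r *\<^sub>R u | r u. 0 < r \<and> r \<le> 1 \<and> u \<in> A}"
      by blast
  next
    fix x assume "x \<in> {r *\<^sub>R u | r u. 0 < r \<and> r \<le> 1 \<and> u \<in> A}"
    then obtain r u where r: "x = r *\<^sub>R u" "0 < r" "r \<le> 1" "u \<in> A"
      by blast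
    moreover from r AS have "norm u = 1" "u \<noteq> 0"
      by auto
    ultimately show "x \<in> sgn -` A \<inter> ?B"
      by (simp add: sgn_div_norm)
  qed
  have "emeasure (distr (restrict_space lborel ?B) (restrict_space borel (sphere 0 1)) sgn) A
      = emeasure (restrict_space lborel ?B) (sgn -` A \<inter> ?B)"
    by (subst emeasure_distr[OF measurable_sgn_sphere A])
       (simp only: space_restrict_space space_lborel space_borel Int_UNIV_right)
  also have "\<dots> = emeasure lborel (sgn -` A \<inter> ?B)"
    using B by (intro emeasure_restrict_space) auto
  finally show ?thesis
    by (simp only: surface_measure_def emeasure_scale_measure eq)
qed

lemma emeasure_surface_measure_sphere:
  "emeasure surface_measure (sphere (0::'a::euclidean_space) 1) =
     of_nat DIM('a) * emeasure lborel (cball (0::'a) 1)"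
proof -
  have S: "sphere (0::'a) 1 \<in> sets (restrict_space borel (sphere 0 1))"
    by (metis sets.top space_borel space_restrict_space inf_top_right)
  have "{r *\<^sub>R u | r u. 0 < r \<and> r \<le> 1 \<and> u \<in> sphere (0::'a) 1} = cball 0 1 - {0}"
  proof (intro equalityI subsetI)
    fix x :: 'a assume "x \<in> cball 0 1 - {0}"
    then have "x = norm x *\<^sub>R sgn x" "0 < norm x" "norm x \<le> 1" "sgn x \<in> sphere 0 1"
      by (auto simp: sgn_div_norm)
    then show "x \<in> {r *\<^sub>R u | r u. 0 < r \<and> r \<le> 1 \<and> u \<in> sphere (0::'a) 1}"
      by blast
  qed auto
  then show ?thesis
    by (simp add: emeasure_surface_measure[OF S] emeasure_Diff)
qed

lemma emeasure_sphere_prob_sphere: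
  "emeasure sphere_prob (sphere (0::'a::euclidean_space) 1) = 1"
proof -
  have "sphere (0::'a) 1 \<in> sets surface_measure"
    using sets.top[of "surface_measure :: 'a measure"] by simp
  moreover have "emeasure lborel (cball (0::'a) 1) \<noteq> 0"
    using content_cball_pos[of 1 "0::'a"] by (auto simp: measure_def)
  moreover have "emeasure lborel (cball (0::'a) 1) < \<infinity>"
    by (rule emeasure_bounded_finite) simp
  then have "of_nat DIM('a) * emeasure lborel (cball (0::'a) 1) < top"
    by (intro ennreal_mult_less_top[THEN iffD2]) (simp add: of_nat_less_top)
  ultimately show ?thesis
    by (auto simp: sphere_prob_def emeasure_surface_measure_sphere intro!: ennreal_divide_self)
qed

end

theory Submission
  imports Defs "HOL-Probability.Probability_Measure"
begin

text \<open>Almost everywhere \<open>1\<^bsub>H(x)\<^esub>(z) - 1/2 = sgn (x \<bullet> z) / 2\<close>, so the squared discrepancy is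
  \<open>1 / (4 N\<^sup>2)\<close> times the sum over all pairs of the correlation
  \<open>K(z, w) = \<integral> sgn (x \<bullet> z) sgn (x \<bullet> w) d\<sigma>(x)\<close>.  Everything reduces to \<open>K = 1 - 2 d\<close> and to
  \<open>\<integral> d(x, y) d\<sigma>(x) = 1/2\<close>, which is antipodal symmetry.  Polar coordinates are avoided:
  invariance of \<open>\<sigma>\<close> under reflections shows how \<open>K\<close> behaves when an acute angle is doubled, and
  together with \<open>K(z, -w) = -K(z, w)\<close> and boundedness this determines \<open>K\<close>.\<close>

section \<open>Lebesgue measure under orthogonal maps\<close>

lemma nn_integral_lborel_translate:
  fixes c :: "'a::euclidean_space"
  assumes [measurable]: "g \<in> borel_measurable borel"
  shows "(\<integral>\<^sup>+x. g (c + x) \<partial>lborel) = (\<integral>\<^sup>+x. g x \<partial>lborel)"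
proof -
  have "(\<integral>\<^sup>+x. g x \<partial>lborel) = (\<integral>\<^sup>+x. g x \<partial>distr lborel borel ((+) c))"
    by (simp add: lborel_distr_plus)
  also have "\<dots> = (\<integral>\<^sup>+x. g (c + x) \<partial>lborel)"
    by (rule nn_integral_distr) auto
  finally show ?thesis ..
qed

lemma borel_measurable_orthogonal_transformation:
  fixes f :: "'a::euclidean_space \<Rightarrow> 'a"
  assumes "orthogonal_transformation f"
  shows "f \<in> borel_measurable borel"
  using assms
  by (intro borel_measurable_continuous_onI linear_continuous_on linear_conv_bounded_linear[THEN iffD1]
        orthogonal_transformation_linear)

text \<open>Integrate \<open>1\<^sub>A (f x + y) 1\<^sub>B (y)\<close>, with \<open>B\<close> the unit ball, in both orders; translation
  invariance and \<open>f ` B = B\<close> turn the two results into \<open>\<lambda>(f\<^sup>-\<^sup>1 A) \<lambda>(B)\<close> and \<open>\<lambda>(A) \<lambda>(B)\<close>.\<close>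
lemma emeasure_lborel_orthogonal_vimage:
  fixes f :: "'a::euclidean_space \<Rightarrow> 'a"
  assumes f: "orthogonal_transformation f" and A [measurable]: "A \<in> sets borel"
  shows "emeasure lborel (f -` A) = emeasure lborel A"
proof -
  note [measurable] = borel_measurable_orthogonal_transformation[OF f]
  have [measurable]: "ball (0::'a) 1 \<in> sets borel"
    by simp
  let ?B = "ball (0::'a) 1" and ?b = "emeasure lborel (ball (0::'a) 1)"
  let ?I = "\<lambda>x y. indicator A (f x + y) * indicator ?B y :: ennreal"
  have lin: "linear f" and iso: "\<And>x. norm (f x) = norm x"
    using f by (auto simp: orthogonal_transformation_linear orthogonal_transformation_norm)
  define g where "g = inv f"
  have g: "f (g y) = y" for y
    unfolding g_def by (rule surj_f_inv_f[OF orthogonal_transformation_surj[OF f]])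
  have "(\<integral>\<^sup>+y. (\<integral>\<^sup>+x. ?I x y \<partial>lborel) \<partial>lborel) = (\<integral>\<^sup>+y. emeasure lborel (f -` A) * indicator ?B y \<partial>lborel)"
  proof (intro nn_integral_cong)
    fix y
    \<comment> \<open>Since \<open>f (g y) = y\<close>, the shift by \<open>y\<close> after
      \<open>f\<close> is a shift by \<open>g y\<close> before \<open>f\<close>, which
      \<open>lborel\<close> does not see.\<close>
    have "(\<integral>\<^sup>+x. ?I x y \<partial>lborel) = (\<integral>\<^sup>+x. indicator A (f (g y + x)) \<partial>lborel) * indicator ?B y"
      by (subst nn_integral_multc) (auto simp: linear_add[OF lin] g add.commute)
    also have "(\<integral>\<^sup>+x. indicator A (f (g y + x)) \<partial>lborel) = (\<integral>\<^sup>+x. indicator A (f x) \<partial>lborel)"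
      by (rule nn_integral_lborel_translate) measurable
    also have "\<dots> = (\<integral>\<^sup>+x. indicator (f -` A) x \<partial>lborel)"
      by (simp add: indicator_def)
    also have "\<dots> = emeasure lborel (f -` A)"
      using measurable_sets[OF borel_measurable_orthogonal_transformation[OF f] A]
      by (subst nn_integral_indicator) auto
    finally show "(\<integral>\<^sup>+x. ?I x y \<partial>lborel) = emeasure lborel (f -` A) * indicator ?B y" .
  qed
  also have "\<dots> = emeasure lborel (f -` A) * ?b"
    by (subst nn_integral_cmult) (auto intro!: borel_measurable_indicator)
  finally have 1: "(\<integral>\<^sup>+y. (\<integral>\<^sup>+x. ?I x y \<partial>lborel) \<partial>lborel) = emeasure lborel (f -` A) * ?b" .
  have "(\<integral>\<^sup>+y. (\<integral>\<^sup>+x. ?I x y \<partial>lborel) \<partial>lborel) = (\<integral>\<^sup>+x. (\<integral>\<^sup>+y. ?I x y \<partial>lborel) \<partial>lborel)"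
    by (rule lborel_pair.Fubini') measurable
  also have "\<dots> = (\<integral>\<^sup>+x. (\<integral>\<^sup>+y. indicator A y * indicator ?B (y - f x) \<partial>lborel) \<partial>lborel)"
  proof (rule nn_integral_cong)
    fix x
    \<comment> \<open>Translating \<open>y\<close> by \<open>- f x\<close> moves \<open>f x\<close>
      out of the indicator of \<open>A\<close> and into that of the ball.\<close>
    have "(\<integral>\<^sup>+y. ?I x (- f x + y) \<partial>lborel) = (\<integral>\<^sup>+y. ?I x y \<partial>lborel)"
      by (rule nn_integral_lborel_translate) measurable
    then show "(\<integral>\<^sup>+y. ?I x y \<partial>lborel) = (\<integral>\<^sup>+y. indicator A y * indicator ?B (y - f x) \<partial>lborel)"
      by simp
  qed
  also have "\<dots> = (\<integral>\<^sup>+y. (\<integral>\<^sup>+x. indicator A y * indicator ?B (y - f x) \<partial>lborel) \<partial>lborel)"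
    by (rule lborel_pair.Fubini') measurable
  also have "\<dots> = (\<integral>\<^sup>+y. ?b * indicator A y \<partial>lborel)"
  proof (intro nn_integral_cong)
    fix y
    \<comment> \<open>As \<open>f\<close> is an isometry, the condition on \<open>x\<close>
      describes a unit ball around \<open>g y\<close>, whose volume does not depend on
      \<open>y\<close>.\<close>
    have "norm (y - f x) = dist (g y) x" for x
      using iso[of "g y - x"] by (simp add: linear_diff[OF lin] g dist_norm)
    then have "(\<integral>\<^sup>+x. indicator A y * indicator ?B (y - f x) \<partial>lborel)
      = (\<integral>\<^sup>+x. indicator A y * indicator (ball (g y) 1) x \<partial>lborel)"
      by (simp add: indicator_def)
    also have "\<dots> = indicator A y * ?b"
      by (subst nn_integral_cmult) (auto simp: emeasure_ball intro!: borel_measurable_indicator)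
    finally show "(\<integral>\<^sup>+x. indicator A y * indicator ?B (y - f x) \<partial>lborel) = ?b * indicator A y"
      by (simp add: mult.commute)
  qed
  also have "\<dots> = emeasure lborel A * ?b"
    by (subst nn_integral_cmult) (auto simp: mult.commute)
  finally have "emeasure lborel (f -` A) * ?b = emeasure lborel A * ?b"
    using 1 by simp
  moreover have "?b \<noteq> 0" "?b \<noteq> \<infinity>"
    using unit_ball_vol_pos[of "real DIM('a)"] by (auto simp: emeasure_ball simp del: unit_ball_vol_pos)
  ultimately show ?thesis
    by (metis ennreal_mult_divide_eq infinity_ennreal_def)
qed

section \<open>The uniform measure on the sphere and its symmetries\<close>

lemma space_sphere_prob [simp]: "space sphere_prob = sphere 0 1"
  by (simp add: sphere_prob_def)

lemma sets_sphere_prob [measurable_cong]: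
  "sets sphere_prob = sets (restrict_space borel (sphere 0 1))"
  by (simp add: sphere_prob_def sets_surface_measure)

lemma borel_measurable_sphere_prob:
  "f \<in> borel_measurable borel \<Longrightarrow> f \<in> borel_measurable sphere_prob"
  by (simp add: measurable_cong_sets[OF sets_sphere_prob refl] measurable_restrict_space1)

lemma prob_space_sphere_prob: "prob_space (sphere_prob :: 'a::euclidean_space measure)"
  by (rule prob_spaceI) (simp add: emeasure_sphere_prob_sphere)

lemma measure_sphere_prob_sphere [simp]: "measure sphere_prob (sphere (0::'a::euclidean_space) 1) = 1"
  by (simp add: measure_def emeasure_sphere_prob_sphere)

text \<open>Writing the cone over \<open>A\<close> as a preimage under \<open>sgn\<close>, not as a
  set of multiples, lets maps that commute with \<open>sgn\<close> be pulled through it.\<close>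

lemma
  fixes A :: "'a::euclidean_space set"
  assumes A: "A \<in> sets (restrict_space borel (sphere 0 1))"
  shows sets_sgn_vimage: "sgn -` A \<inter> {x. 0 < norm x \<and> norm x \<le> 1} \<in> sets borel"
    and emeasure_surface_measure_sgn: "emeasure surface_measure A =
      of_nat DIM('a) * emeasure lborel (sgn -` A \<inter> {x. 0 < norm x \<and> norm x \<le> 1})"
proof -
  let ?B = "{x::'a. 0 < norm x \<and> norm x \<le> 1}"
  have B: "?B \<in> sets borel"
    by simp
  have "sgn -` A \<inter> ?B \<in> sets (restrict_space lborel ?B)"
    using measurable_sets[OF measurable_sgn_sphere A] by (simp add: space_restrict_space)
  then show "sgn -` A \<inter> ?B \<in> sets borel"
    using B by (subst (asm) sets_restrict_space_iff) auto
  have "emeasure (distr (restrict_space lborel ?B) (restrict_space borel (sphere 0 1)) sgn) A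
      = emeasure (restrict_space lborel ?B) (sgn -` A \<inter> ?B)"
    by (subst emeasure_distr[OF measurable_sgn_sphere A])
       (simp only: space_restrict_space space_lborel space_borel Int_UNIV_right)
  also have "\<dots> = emeasure lborel (sgn -` A \<inter> ?B)"
    using B by (intro emeasure_restrict_space) auto
  finally show "emeasure surface_measure A = of_nat DIM('a) * emeasure lborel (sgn -` A \<inter> ?B)"
    by (simp only: surface_measure_def emeasure_scale_measure)
qed

lemma emeasure_sphere_prob:
  assumes "A \<in> sets (restrict_space borel (sphere (0::'a::euclidean_space) 1))"
  shows "emeasure sphere_prob A =
    emeasure surface_measure A / emeasure surface_measure (sphere (0::'a) 1)"
proof -
  have "A \<inter> sphere 0 1 = A" "sphere (0::'a) 1 \<in> sets surface_measure"
    using sets.sets_into_space[OF assms] sets.top[of "surface_measure :: 'a measure"]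
    by (auto simp: space_restrict_space)
  then show ?thesis
    using assms by (simp add: sphere_prob_def sets_surface_measure Int_commute)
qed

lemma measurable_sphere_prob_orthogonal:
  fixes f :: "'a::euclidean_space \<Rightarrow> 'a"
  assumes f: "orthogonal_transformation f"
  shows "f \<in> sphere_prob \<rightarrow>\<^sub>M sphere_prob"
proof -
  have "f \<in> sphere_prob \<rightarrow>\<^sub>M restrict_space borel (sphere 0 1)"
    using f by (intro measurable_restrict_space2 borel_measurable_sphere_prob
        borel_measurable_orthogonal_transformation) (auto simp: orthogonal_transformation_norm)
  then show ?thesis
    by (simp add: measurable_cong_sets[OF refl sets_sphere_prob])
qed

text \<open>An orthogonal map preserves norms and commutes with \<open>sgn\<close>, so the cone over
  the preimage of \<open>A\<close> is the preimage of the cone over \<open>A\<close>; invariance of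
  \<open>lborel\<close> does the rest.\<close>

lemma distr_sphere_prob_orthogonal:
  fixes f :: "'a::euclidean_space \<Rightarrow> 'a"
  assumes f: "orthogonal_transformation f"
  shows "distr sphere_prob sphere_prob f = sphere_prob"
proof (rule measure_eqI)
  fix A assume "A \<in> sets (distr sphere_prob sphere_prob f)"
  then have A: "A \<in> sets (restrict_space borel (sphere 0 1))"
    by (simp add: sets_sphere_prob)
  let ?A = "f -` A \<inter> sphere 0 1" and ?B = "{x::'a. 0 < norm x \<and> norm x \<le> 1}"
  have A': "?A \<in> sets (restrict_space borel (sphere 0 1))"
    using measurable_sets[OF measurable_sphere_prob_orthogonal[OF f], of A] A
    by (simp add: sets_sphere_prob)
  have "f (sgn x) = sgn (f x)" for x
    using f by (simp add: sgn_div_norm orthogonal_transformation_norm orthogonal_transformation_scaleR)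
  moreover have "f x = 0 \<longleftrightarrow> x = 0" for x
    by (metis norm_eq_zero orthogonal_transformation_norm[OF f])
  ultimately have "sgn -` ?A \<inter> ?B = f -` (sgn -` A \<inter> ?B)"
    using f by (auto simp: orthogonal_transformation_norm norm_sgn)
  then have "emeasure surface_measure ?A = emeasure surface_measure A"
    by (simp only: emeasure_surface_measure_sgn[OF A] emeasure_surface_measure_sgn[OF A']
        emeasure_lborel_orthogonal_vimage[OF f sets_sgn_vimage[OF A]])
  then show "emeasure (distr sphere_prob sphere_prob f) A = emeasure sphere_prob A"
    using A A' measurable_sphere_prob_orthogonal[OF f]
    by (simp add: emeasure_distr emeasure_sphere_prob sets_sphere_prob)
qed simp

lemma integral_sphere_prob_orthogonal:
  fixes f :: "'a::euclidean_space \<Rightarrow> 'a" and g :: "'a \<Rightarrow> real"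
  assumes f: "orthogonal_transformation f" and g: "g \<in> borel_measurable sphere_prob"
  shows "(\<integral>x. g (f x) \<partial>sphere_prob) = (\<integral>x. g x \<partial>sphere_prob)"
  using integral_distr[OF measurable_sphere_prob_orthogonal[OF f] g]
  by (simp add: distr_sphere_prob_orthogonal[OF f])

text \<open>The cone over the exceptional set lies in the hyperplane orthogonal to \<open>z\<close>,
  a Lebesgue null set. This disposes of the \<open>x\<close> whose hemisphere has \<open>z\<close>
  on its boundary, where \<open>sgn\<close> is 0.\<close>

lemma AE_sphere_prob_inner_nonzero:
  fixes z :: "'a::euclidean_space"
  assumes "z \<noteq> 0"
  shows "AE x in sphere_prob. x \<bullet> z \<noteq> 0"
proof (rule AE_I)
  let ?N = "{x \<in> sphere 0 1. x \<bullet> z = 0}" and ?H = "{x. z \<bullet> x = 0}"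
  have "{x. x \<bullet> z = 0} \<in> sets borel"
    by measurable
  then have N: "?N \<in> sets (restrict_space borel (sphere 0 1))"
    by (auto simp: sets_restrict_space)
  then show "?N \<in> sets sphere_prob"
    by (simp add: sets_sphere_prob)
  have "?H \<in> sets borel"
    by measurable
  moreover have "negligible ?H"
    using assms by (intro negligible_hyperplane) auto
  ultimately have H: "?H \<in> null_sets lborel"
    by (simp add: negligible_iff_null_sets null_sets_completion_iff)
  have "sgn -` ?N \<inter> {x. 0 < norm x \<and> norm x \<le> 1} \<subseteq> ?H"
    by (auto simp: sgn_div_norm inner_commute)
  then have "sgn -` ?N \<inter> {x. 0 < norm x \<and> norm x \<le> 1} \<in> null_sets lborel"
    using sets_sgn_vimage[OF N] by (intro null_sets_subset[OF H]) auto
  then have "emeasure lborel (sgn -` ?N \<inter> {x. 0 < norm x \<and> norm x \<le> 1}) = 0"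
    by (rule null_setsD1)
  then show "emeasure sphere_prob ?N = 0"
    by (simp only: emeasure_sphere_prob[OF N] emeasure_surface_measure_sgn[OF N]) simp
qed auto

section \<open>Sign correlation and geodesic distance\<close>

definition sgn_corr :: "'a::euclidean_space \<Rightarrow> 'a \<Rightarrow> real" where
  "sgn_corr z w = (\<integral>x. sgn (x \<bullet> z) * sgn (x \<bullet> w) \<partial>sphere_prob)"

lemma integrable_sgn_inner:
  fixes z w :: "'a::euclidean_space"
  shows "integrable sphere_prob (\<lambda>x. sgn (x \<bullet> z) * sgn (x \<bullet> w))"
proof -
  interpret prob_space "sphere_prob :: 'a measure"
    by (rule prob_space_sphere_prob)
  have "(\<lambda>x. sgn (x \<bullet> z) * sgn (x \<bullet> w)) \<in> borel_measurable sphere_prob"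
    by (rule borel_measurable_sphere_prob) measurable
  then show ?thesis
    by (auto intro!: integrable_const_bound[where B=1] simp: abs_mult sgn_if)
qed

lemma abs_sgn_corr_le:
  fixes z w :: "'a::euclidean_space"
  shows "\<bar>sgn_corr z w\<bar> \<le> 1"
proof -
  interpret prob_space "sphere_prob :: 'a measure"
    by (rule prob_space_sphere_prob)
  have "\<bar>sgn_corr z w\<bar> \<le> (\<integral>x. \<bar>sgn (x \<bullet> z) * sgn (x \<bullet> w)\<bar> \<partial>sphere_prob)"
    unfolding sgn_corr_def by (rule integral_abs_bound)
  also have "\<dots> \<le> (\<integral>x. 1 \<partial>(sphere_prob :: 'a measure))"
    by (intro Bochner_Integration.integral_mono integrable_abs integrable_sgn_inner) (auto simp: abs_mult sgn_if)
  finally show ?thesis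
    by simp
qed

text \<open>Because \<open>sgn 0 = 0\<close>, the integrand is odd in \<open>w\<close> at every
  point and no null set has to be discarded.\<close>

lemma sgn_corr_minus: "sgn_corr z (- w) = - sgn_corr z w"
  by (simp add: sgn_corr_def sgn_minus)

lemma sgn_corr_commute: "sgn_corr z w = sgn_corr w z"
  by (simp add: sgn_corr_def mult.commute)

lemma sgn_corr_orthogonal:
  fixes f :: "'a::euclidean_space \<Rightarrow> 'a"
  assumes f: "orthogonal_transformation f"
  shows "sgn_corr (f z) (f w) = sgn_corr z w"
proof -
  have "sgn_corr (f z) (f w) = (\<integral>x. sgn (f x \<bullet> f z) * sgn (f x \<bullet> f w) \<partial>sphere_prob)"
    unfolding sgn_corr_def
    by (rule integral_sphere_prob_orthogonal[OF f, symmetric])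
       (rule borel_measurable_integrable[OF integrable_sgn_inner])
  then show ?thesis
    using f by (simp add: sgn_corr_def orthogonal_transformation_def)
qed

text \<open>The point \<open>2 (z \<bullet> w) w - z\<close> is the mirror image of \<open>z\<close> in the line through \<open>w\<close>, so
  passing to it doubles the angle.  Since \<open>z + z' = 2 (z \<bullet> w) w\<close>, the sign at \<open>w\<close> agrees with
  those at \<open>z\<close> and \<open>z'\<close> whenever the latter coincide.\<close>
lemma sgn_corr_double:
  fixes z w :: "'a::euclidean_space"
  assumes z: "norm z = 1" and w: "norm w = 1" and zw: "z \<bullet> w \<ge> 0"
  shows "sgn_corr z ((2 * (z \<bullet> w)) *\<^sub>R w - z) = 2 * sgn_corr z w - 1"
proof -
  interpret prob_space "sphere_prob :: 'a measure"
    by (rule prob_space_sphere_prob)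
  define R where "R x = (2 * (x \<bullet> w)) *\<^sub>R w - x" for x
  have ww: "w \<bullet> w = 1"
    using w by (simp add: norm_eq_1)
  have R: "orthogonal_transformation R"
    unfolding orthogonal_transformation_def
  proof (intro conjI allI)
    show "linear R"
      by (rule linearI) (simp_all add: R_def algebra_simps)
    show "R x \<bullet> R y = x \<bullet> y" for x y
      by (simp add: R_def ww inner_commute[of w y] algebra_simps)
  qed
  have Rw: "R w = w"
    by (simp add: R_def ww scaleR_2)
  have "norm (R z) = 1"
    by (simp add: orthogonal_transformation_norm[OF R] z)
  then have nz: "z \<noteq> 0" "w \<noteq> 0" "R z \<noteq> 0"
    using z w by auto
  \<comment> \<open>\<open>R\<close> is orthogonal and fixes \<open>w\<close>, so \<open>z\<close>
    and its mirror image correlate equally with \<open>w\<close>; this gives the factor 2.\<close>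
  have corr_R: "sgn_corr w (R z) = sgn_corr z w"
    using sgn_corr_orthogonal[OF R, of w z] by (simp add: Rw sgn_corr_commute)
  \<comment> \<open>For signs a, b, c with c = a whenever a = b, ab + 1 = ac + cb: both sides are 2
    if a = b and 0 if b = -a. Here c is the sign at \<open>w\<close>; \<open>zw\<close> keeps the
    coefficient of \<open>x \<bullet> w\<close> in \<open>sum\<close> nonnegative.\<close>
  have "AE x in sphere_prob. sgn (x \<bullet> z) * sgn (x \<bullet> R z) + 1
      = sgn (x \<bullet> z) * sgn (x \<bullet> w) + sgn (x \<bullet> w) * sgn (x \<bullet> R z)"
    using nz[THEN AE_sphere_prob_inner_nonzero]
  proof eventually_elim
    case (elim x)
    have sum: "x \<bullet> z + x \<bullet> R z = 2 * (z \<bullet> w) * (x \<bullet> w)"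
      by (simp add: R_def inner_diff_right)
    have "x \<bullet> z + x \<bullet> R z \<le> 0" if "x \<bullet> w < 0"
      unfolding sum using that zw by (intro mult_nonneg_nonpos) auto
    moreover have "x \<bullet> z + x \<bullet> R z \<ge> 0" if "x \<bullet> w > 0"
      unfolding sum using that zw by simp
    ultimately show ?case
      using elim by (auto simp: sgn_if)
  qed
  then have "(\<integral>x. sgn (x \<bullet> z) * sgn (x \<bullet> R z) + 1 \<partial>sphere_prob)
      = (\<integral>x. sgn (x \<bullet> z) * sgn (x \<bullet> w) + sgn (x \<bullet> w) * sgn (x \<bullet> R z) \<partial>sphere_prob)"
    by (intro integral_cong_AE borel_measurable_add borel_measurable_const
        borel_measurable_integrable[OF integrable_sgn_inner])
  then have "sgn_corr z (R z) + 1 = sgn_corr z w + sgn_corr w (R z)"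
    by (simp add: sgn_corr_def integrable_sgn_inner)
  then have "sgn_corr z (R z) = 2 * sgn_corr z w - 1"
    using corr_R by simp
  then show ?thesis
    by (simp add: R_def)
qed

text \<open>For nonnegative \<open>t\<close> the angle \<open>arccos t\<close> is at most pi/2, so
  its double stays in [0, pi], where \<open>arccos\<close> inverts \<open>cos\<close>. This is the
  counterpart of \<open>sgn_corr_double\<close> for the distance.\<close>

lemma arccos_double:
  assumes "0 \<le> t" "t \<le> 1"
  shows "arccos (2 * t\<^sup>2 - 1) = 2 * arccos t"
proof -
  have "arccos t \<le> pi / 2"
    using assms by (intro arccos_le_pi2) auto
  moreover have "cos (2 * arccos t) = 2 * t\<^sup>2 - 1"
    using assms by (simp add: cos_double_cos cos_arccos)
  ultimately show ?thesis
    using assms arccos_cos[of "2 * arccos t"] arccos_lbound[of t] by simp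
qed

text \<open>The difference of the two sides is bounded, odd in \<open>w\<close>, and doubles with the angle as long
  as that is acute; hence it vanishes.\<close>
lemma sgn_corr_eq:
  fixes z w :: "'a::euclidean_space"
  assumes "norm z = 1" "norm w = 1"
  shows "sgn_corr z w = 1 - 2 * geo_dist z w"
proof -
  define F where "F w = sgn_corr z w - (1 - 2 * geo_dist z w)" for w
  have cs: "\<bar>z \<bullet> v\<bar> \<le> 1" if "norm v = 1" for v
    using Cauchy_Schwarz_ineq2[of z v] assms(1) that by simp
  have F_minus: "F (- v) = - F v" if "norm v = 1" for v
    using cs[OF that] by (simp add: F_def sgn_corr_minus geo_dist_def arccos_minus field_simps)
  have F_double: "\<exists>v'. norm v' = 1 \<and> F v' = 2 * F v" if v: "norm v = 1" "z \<bullet> v \<ge> 0" for v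
  proof (intro exI conjI)
    let ?v = "(2 * (z \<bullet> v)) *\<^sub>R v - z"
    have "?v \<bullet> ?v = 1"
      using assms(1) v(1)
      by (simp add: norm_eq_1 inner_commute[of v z] algebra_simps)
    then show "norm ?v = 1"
      by (simp add: norm_eq_1)
    have "z \<bullet> ?v = 2 * (z \<bullet> v)\<^sup>2 - 1"
      using assms(1) by (simp add: norm_eq_1 inner_diff_right power2_eq_square)
    then show "F ?v = 2 * F v"
      using cs[OF v(1)] v
      by (simp add: F_def sgn_corr_double assms(1) geo_dist_def arccos_double)
  qed
  \<comment> \<open>If the angle is obtuse, \<open>- v\<close> has an acute one and the same
    absolute value of \<open>F\<close>.\<close>
  have F_abs_double: "\<exists>v'. norm v' = 1 \<and> \<bar>F v'\<bar> = 2 * \<bar>F v\<bar>" if v: "norm v = 1" for v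
  proof (cases "z \<bullet> v \<ge> 0")
    case True
    then show ?thesis
      using F_double[of v] v by fastforce
  next
    case False
    then show ?thesis
      using F_double[of "- v"] F_minus[OF v] v by fastforce
  qed
  \<comment> \<open>The 2 on the right bounds \<open>F\<close> on the unit sphere:
    \<open>sgn_corr\<close> and \<open>1 - 2 * geo_dist\<close> both lie in [-1, 1]. Each doubling
    changes the vector, so \<open>v\<close> is generalized in the induction.\<close>
  have "2 ^ n * \<bar>F v\<bar> \<le> 2" if "norm v = 1" for n v
    using that
  proof (induction n arbitrary: v)
    case 0
    have "0 \<le> geo_dist z v" "geo_dist z v \<le> 1"
      using cs[OF 0] by (auto simp: geo_dist_def arccos_lbound arccos_ubound)
    then show ?case
      using abs_sgn_corr_le[of z v] by (simp add: F_def)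
  next
    case (Suc n)
    then show ?case
      using F_abs_double[of v] by fastforce
  qed
  note bound = this[OF assms(2)]
  have "F w = 0"
  proof (rule ccontr)
    assume "F w \<noteq> 0"
    obtain n where "2 / \<bar>F w\<bar> < 2 ^ n"
      using real_arch_pow[of 2 "2 / \<bar>F w\<bar>"] by auto
    then show False
      using bound[of n] \<open>F w \<noteq> 0\<close> by (simp add: field_simps)
  qed
  then show ?thesis
    by (simp add: F_def)
qed

text \<open>On the sphere \<open>geo_dist (- x) y = 1 - geo_dist x y\<close>, and the antipodal map
  preserves the measure; hence the integral I satisfies I = 1 - I.\<close>

lemma integral_geo_dist:
  fixes y :: "'a::euclidean_space"
  assumes y: "norm y = 1"
  shows "(\<integral>x. geo_dist x y \<partial>sphere_prob) = 1 / 2"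
proof -
  interpret prob_space "sphere_prob :: 'a measure"
    by (rule prob_space_sphere_prob)
  have cs: "- 1 \<le> x \<bullet> y \<and> x \<bullet> y \<le> 1" if "norm x = 1" for x
    using Cauchy_Schwarz_ineq2[of x y] y that by (simp add: abs_le_iff)
  \<comment> \<open>Measurability is derived on the sphere only, where the inner product stays in
    [-1, 1] and \<open>arccos\<close> is continuous.\<close>
  have "continuous_on (sphere 0 1) (\<lambda>x. geo_dist x y)"
    unfolding geo_dist_def using cs by (auto intro!: continuous_intros)
  then have meas: "(\<lambda>x. geo_dist x y) \<in> borel_measurable sphere_prob"
    by (simp add: measurable_cong_sets[OF sets_sphere_prob refl] borel_measurable_continuous_on_restrict)
  have "\<bar>geo_dist x y\<bar> \<le> 1" if "norm x = 1" for x
    using cs[OF that] by (auto simp: geo_dist_def arccos_lbound arccos_ubound abs_mult)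
  then have int: "integrable sphere_prob (\<lambda>x. geo_dist x y)"
    using meas by (intro integrable_const_bound[where B=1]) auto
  have "(\<integral>x. geo_dist x y \<partial>sphere_prob) = (\<integral>x. geo_dist (- x) y \<partial>sphere_prob)"
    using integral_sphere_prob_orthogonal[OF _ meas, of uminus]
      orthogonal_transformation_neg[of "\<lambda>x::'a. x"] by simp
  also have "\<dots> = (\<integral>x. 1 - geo_dist x y \<partial>sphere_prob)"
    using cs by (intro Bochner_Integration.integral_cong)
      (auto simp: geo_dist_def arccos_minus field_simps)
  also have "\<dots> = 1 - (\<integral>x. geo_dist x y \<partial>sphere_prob)"
    using int by simp
  finally show ?thesis
    by simp
qed

section \<open>Expansion of the squared discrepancy\<close>

theorem theorem3p3:
  fixes d N :: nat and Z :: "(real ^ 'n) set"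
  assumes "d \<ge> 1" and "CARD('n) = d + 1"
    and "N \<ge> 1" and "finite Z" and "card Z = N" and "Z \<subseteq> sphere 0 1"
  shows "(hem_discrepancy Z)\<^sup>2 =
    1 / 2 * ((\<integral>y. (\<integral>x. geo_dist x y \<partial>sphere_prob) \<partial>(sphere_prob :: (real ^ 'n) measure))
             - 1 / (real N)\<^sup>2 * (\<Sum>z\<in>Z. \<Sum>w\<in>Z. geo_dist z w))"
proof -
  interpret prob_space "sphere_prob :: (real ^ 'n) measure"
    by (rule prob_space_sphere_prob)
  have N: "real N \<noteq> 0"
    using assms(3) by simp
  have Z: "norm z = 1" if "z \<in> Z" for z
    using assms(6) that by auto
  let ?D = "\<lambda>x::real ^ 'n. \<bar>(1 / real N) * (\<Sum>z\<in>Z. indicat_real (hemisphere x) z) - 1 / 2\<bar>\<^sup>2"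
  \<comment> \<open>Each centred indicator is half a sign, so the deviation is the sum of the signs
    over \<open>2 * N\<close>; squaring it gives the factor and the double sum.\<close>
  let ?E = "\<lambda>x. 1 / (4 * (real N)\<^sup>2) * (\<Sum>z\<in>Z. \<Sum>w\<in>Z. sgn (x \<bullet> z) * sgn (x \<bullet> w))"
  have sq: "?D x = ?E x" if "\<forall>z\<in>Z. x \<bullet> z \<noteq> 0" for x
  proof -
    have "indicat_real (hemisphere x) z = 1 / 2 + sgn (x \<bullet> z) / 2" if "z \<in> Z" for z
      using that Z \<open>\<forall>z\<in>Z. x \<bullet> z \<noteq> 0\<close>
      by (auto simp: hemisphere_def indicator_def sgn_if inner_commute)
    then have "(\<Sum>z\<in>Z. indicat_real (hemisphere x) z) = real N / 2 + (\<Sum>z\<in>Z. sgn (x \<bullet> z)) / 2"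
      by (simp add: sum.distrib sum_divide_distrib assms(5))
    then have "(1 / real N) * (\<Sum>z\<in>Z. indicat_real (hemisphere x) z) - 1 / 2
        = (\<Sum>z\<in>Z. sgn (x \<bullet> z)) / (2 * real N)"
      using N by (simp add: field_simps)
    then have "?D x = ((\<Sum>z\<in>Z. sgn (x \<bullet> z)) / (2 * real N))\<^sup>2"
      by (simp only: power2_abs)
    also have "\<dots> = ?E x"
      by (simp add: power_divide power_mult_distrib power2_eq_square[of "sum _ _"] sum_product)
    finally show ?thesis .
  qed
  have "z \<noteq> 0" if "z \<in> Z" for z
    using Z[OF that] by auto
  then have "AE x in sphere_prob. \<forall>z\<in>Z. x \<bullet> z \<noteq> 0"
    using assms(4) by (intro AE_finite_allI AE_sphere_prob_inner_nonzero)
  then have AE: "AE x in sphere_prob. ?D x = ?E x"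
    by eventually_elim (rule sq)
  \<comment> \<open>Measurability is needed in the centre \<open>x\<close>, so membership of
    \<open>z\<close> in \<open>hemisphere x\<close> is recast as membership of \<open>x\<close> in a
    fixed half-space.\<close>
  have "indicat_real (hemisphere x) z = indicat_real {x. x \<bullet> z > 0} x" if "z \<in> Z" for x z
    using Z[OF that] by (auto simp: hemisphere_def indicator_def inner_commute)
  then have "?D = (\<lambda>x. \<bar>(1 / real N) * (\<Sum>z\<in>Z. indicat_real {x. x \<bullet> z > 0} x) - 1 / 2\<bar>\<^sup>2)"
    by (simp cong: sum.cong)
  moreover have "\<dots> \<in> borel_measurable sphere_prob"
    by (rule borel_measurable_sphere_prob) measurable
  ultimately have D: "?D \<in> borel_measurable sphere_prob"
    by simp
  have E: "integrable sphere_prob ?E"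
    by (intro integrable_mult_right Bochner_Integration.integrable_sum integrable_sgn_inner)
  have "(hem_discrepancy Z)\<^sup>2 = (\<integral>x. ?D x \<partial>sphere_prob)"
    by (simp add: hem_discrepancy_def assms(5))
  also have "\<dots> = (\<integral>x. ?E x \<partial>sphere_prob)"
    using AE D E by (intro integral_cong_AE) auto
  also have "\<dots> = 1 / (4 * (real N)\<^sup>2) * (\<Sum>z\<in>Z. \<Sum>w\<in>Z. sgn_corr z w)"
    by (simp add: sgn_corr_def integrable_sgn_inner)
  also have "(\<Sum>z\<in>Z. \<Sum>w\<in>Z. sgn_corr z w) = (\<Sum>z\<in>Z. \<Sum>w\<in>Z. 1 - 2 * geo_dist z w)"
    by (intro sum.cong refl sgn_corr_eq Z)
  also have "\<dots> = (real N)\<^sup>2 - 2 * (\<Sum>z\<in>Z. \<Sum>w\<in>Z. geo_dist z w)"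
    by (simp add: sum_subtractf sum_distrib_left assms(5) power2_eq_square)
  \<comment> \<open>The inner 1/2 is isolated because it equals the mean distance, as computed
    next.\<close>
  finally have "(hem_discrepancy Z)\<^sup>2 =
      1 / 2 * (1 / 2 - 1 / (real N)\<^sup>2 * (\<Sum>z\<in>Z. \<Sum>w\<in>Z. geo_dist z w))"
    using N by (simp add: field_simps)
  moreover have "(\<integral>y. (\<integral>x. geo_dist x y \<partial>sphere_prob) \<partial>(sphere_prob :: (real ^ 'n) measure))
      = (\<integral>y. 1 / 2 \<partial>(sphere_prob :: (real ^ 'n) measure))"
    by (intro Bochner_Integration.integral_cong) (auto simp: integral_geo_dist)
  ultimately show ?thesis
    by simp
qed

end
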